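(* Let $F(X,Z)$ be a totally complex form (i.e. a real binary form with no real roots) factored over $\mathbb{R}$ as $$F(X,Z)=\prod_{i=1}^r(X^2+a_iXZ+b_iZ^2),$$ and put $d_i=\sqrt{4b_i-a_i^2}$ for $i=1,\dots,r$, $\mathbf{d}=(d_1,\dots,d_r)$, $\mathbf{a}=(a_1,\dots,a_r)$, $\mathbf{b}=(b_1,\dots,b_r)$. Then the image $\xi_{\mathcal{C}}(F)=t+\mathbf{i}u\in\mathcal{H}_2$ of $F$ under the hyperbolic center zero map is given by $$t=-\frac12\,\psi(\mathbf{a},\mathbf{d}),\qquad u^2=\psi(\mathbf{b},\mathbf{d})-\frac14\,\psi^2(\mathbf{a},\mathbf{d}),$$ where $\psi^2(\mathbf{a},\mathbf{d})=(\psi(\mathbf{a},\mathbf{d}))^2$. The hyperbolic center quadratic $\mathcal{J}^{\mathcal{C}}_F$ is defined over $\mathbb{Q}(\sqrt{d_1},\dots,\sqrt{d_r})$.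
   Context: $\mathcal{H}_2$ is the upper half-plane. For $\alpha_j=x_j+\mathbf{i}y_j\in\mathcal{H}_2$, $j=1,\dots,n$, the hyperbolic center of mass $\mathcal{C}_{\mathcal{H}}(\alpha_1,\dots,\alpha_n)$ is the unique point $t+\mathbf{i}u\in\mathcal{H}_2$ that minimizes $$\sum_{j=1}^n\frac{(t-x_j)^2+(u-y_j)^2}{uy_j}.$$ Let $F(X,Z)$ be a real binary form of degree $2n$ with no real roots, factored as $F(X,Z)=\prod_{i=1}^n(X-\alpha_iZ)(X-\overline{\alpha_i}Z)$ with $\alpha_i\in\mathcal{H}_2$. The hyperbolic center zero map is $\xi_{\mathcal{C}}(F):=\mathcal{C}=\mathcal{C}_{\mathcal{H}}(\alpha_1,\dots,\alpha_n)\in\mathcal{H}_2$, and the hyperbolic center quadratic of $F$ is $\mathcal{J}^{\mathcal{C}}_F=(X-\mathcal{C}Z)(X-\overline{\mathcal{C}}Z)$. A form is defined over a field if its coefficients lie in that field. The function $\psi$ is defined, for $\mathbf{x}=(x_1,\dots,x_n)\in\mathbb{R}^n$ and $\mathbf{y}=(y_1,\dots,y_n)\in\mathbb{R}^n$ (with nonzero denominator), by $$\psi(\mathbf{x},\mathbf{y})=\frac{\sum_{i=1}^ny_1y_2\cdots y_{i-1}\,x_i\,y_{i+1}\cdots y_n}{\sum_{i=1}^ny_1y_2\cdots y_{i-1}\,y_{i+1}\cdots y_n}.$$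
   Formalization: The last sentence fails for arbitrary real F (r=1, a=√2, b=3/4: d=1 and J=F is not over Q). It is proved instead that if the coefficients of F lie in a subfield k of C, then J is defined over k(√d_1,…,√d_r); k=Q gives the stated field for rational F. *)

theory Defs
  imports Complex_Main "HOL-Computational_Algebra.Polynomial"
begin

section \<open>Binary forms\<close>

text \<open>
  A binary form in \<open>X, Z\<close> is an element of \<open>R[Z][X]\<close>, i.e. a polynomial in \<open>X\<close> whose
  coefficients are polynomials in \<open>Z\<close>; \<open>coeff (coeff F i) j\<close> is the coefficient of
  \<open>X^i Z^j\<close>.
\<close>

definition var_X :: "'a::comm_ring_1 poly poly" where
  "var_X = [:0, 1:]"

definition var_Z :: "'a::comm_ring_1 poly poly" where
  "var_Z = [:[:0, 1:]:]"

definition const_form :: "'a::comm_ring_1 \<Rightarrow> 'a poly poly" where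
  "const_form c = [:[:c:]:]"

definition is_binary_form :: "nat \<Rightarrow> 'a::comm_ring_1 poly poly \<Rightarrow> bool" where
  "is_binary_form m F \<longleftrightarrow> (\<forall>i j. coeff (coeff F i) j \<noteq> 0 \<longrightarrow> i + j = m)"

definition form_eval :: "'a::comm_ring_1 poly poly \<Rightarrow> 'a \<Rightarrow> 'a \<Rightarrow> 'a" where
  "form_eval F x z = poly (poly F [:x:]) z"

text \<open>Roots of a form are points of the projective line, so \<open>(0, 0)\<close> is excluded.\<close>

definition totally_complex :: "real poly poly \<Rightarrow> bool" where
  "totally_complex F \<longleftrightarrow> (\<exists>m. is_binary_form m F) \<and>
     (\<forall>x z. (x, z) \<noteq> (0, 0) \<longrightarrow> form_eval F x z \<noteq> 0)"

definition complexify :: "real poly poly \<Rightarrow> complex poly poly" where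
  "complexify F = map_poly (map_poly complex_of_real) F"

text \<open>\<open>(X - \<alpha> Z)(X - cnj \<alpha> Z)\<close>\<close>

definition conj_quadratic :: "complex \<Rightarrow> complex poly poly" where
  "conj_quadratic \<alpha> =
     (var_X - const_form \<alpha> * var_Z) * (var_X - const_form (cnj \<alpha>) * var_Z)"

section \<open>The hyperbolic center of mass\<close>

definition upper_half_plane :: "complex set" where
  "upper_half_plane = {w. 0 < Im w}"

definition hyp_center_cost :: "complex list \<Rightarrow> complex \<Rightarrow> real" where
  "hyp_center_cost \<alpha>s w =
     (\<Sum>\<alpha>\<leftarrow>\<alpha>s. ((Re w - Re \<alpha>)\<^sup>2 + (Im w - Im \<alpha>)\<^sup>2) / (Im w * Im \<alpha>))"

definition hyp_center :: "complex list \<Rightarrow> complex" where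
  "hyp_center \<alpha>s =
     (THE w. is_arg_min (hyp_center_cost \<alpha>s) (\<lambda>v. v \<in> upper_half_plane) w)"

text \<open>
  The roots in the upper half plane, with multiplicity, listed in an arbitrary order; the
  order is irrelevant below because \<open>hyp_center_cost\<close> is symmetric in the points.
\<close>

definition upper_roots :: "real poly poly \<Rightarrow> complex list" where
  "upper_roots F =
     (SOME \<alpha>s. set \<alpha>s \<subseteq> upper_half_plane \<and> complexify F = (\<Prod>\<alpha>\<leftarrow>\<alpha>s. conj_quadratic \<alpha>))"

definition hyp_center_zero_map :: "real poly poly \<Rightarrow> complex" where
  "hyp_center_zero_map F = hyp_center (upper_roots F)"

definition hyp_center_quadratic :: "real poly poly \<Rightarrow> complex poly poly" where
  "hyp_center_quadratic F = conj_quadratic (hyp_center_zero_map F)"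

section \<open>The function psi\<close>

definition psi :: "nat \<Rightarrow> (nat \<Rightarrow> real) \<Rightarrow> (nat \<Rightarrow> real) \<Rightarrow> real" where
  "psi n x y =
     (\<Sum>i = 1..n. (\<Prod>j = 1..<i. y j) * x i * (\<Prod>j = i+1..n. y j)) /
     (\<Sum>i = 1..n. (\<Prod>j = 1..<i. y j) * (\<Prod>j = i+1..n. y j))"

section \<open>Fields of definition\<close>

definition is_subfield :: "'a::field set \<Rightarrow> bool" where
  "is_subfield K \<longleftrightarrow> 0 \<in> K \<and> 1 \<in> K \<and>
     (\<forall>x\<in>K. \<forall>y\<in>K. x + y \<in> K \<and> x * y \<in> K) \<and> (\<forall>x\<in>K. - x \<in> K \<and> inverse x \<in> K)"

definition adjoin :: "'a::field set \<Rightarrow> 'a set \<Rightarrow> 'a set" where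
  "adjoin K S = \<Inter>{L. is_subfield L \<and> K \<union> S \<subseteq> L}"

definition defined_over :: "'a::field set \<Rightarrow> 'a poly poly \<Rightarrow> bool" where
  "defined_over K F \<longleftrightarrow> (\<forall>i j. coeff (coeff F i) j \<in> K)"

lemma is_subfield_Rats: "is_subfield (\<rat> :: 'a::field_char_0 set)"
  unfolding is_subfield_def by auto

lemma is_subfield_adjoin: "is_subfield (adjoin K S)"
  unfolding is_subfield_def adjoin_def by auto

end

theory Submission
  imports Defs "HOL-Computational_Algebra.Fundamental_Theorem_Algebra"
begin

text \<open>
  Written as \<open>(S / Im w) |w - w\<^sub>0|\<^sup>2 + const\<close> with \<open>S = \<Sum> 1 / y\<^sub>j\<close>, the cost function visibly has the
  unique minimum \<open>w\<^sub>0\<close>; completing squares gives \<open>Re w\<^sub>0\<close> and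
  \<open>|w\<^sub>0|\<^sup>2\<close> as the means of \<open>x\<^sub>j\<close> and \<open>|\<alpha>\<^sub>j|\<^sup>2\<close> with weights \<open>1 / y\<^sub>j\<close> (\<open>hyp_center_closed_form\<close>).
  The function \<open>\<psi>(\<cdot>, d)\<close> is the mean with weights \<open>1 / d\<^sub>j\<close>, and the quadratic factor
  \<open>X\<^sup>2 + a X Z + b Z\<^sup>2\<close> has the root \<open>(- a + \<i> d) / 2\<close> of squared modulus \<open>b\<close>. This gives the formulas for
  the center, once the multiset of upper roots is known to be determined by the form.

  The coefficients of the center quadratic are therefore \<open>1\<close>, \<open>\<psi>(a, d)\<close> and \<open>\<psi>(b, d)\<close>. The \<open>a\<^sub>j\<close> and
  \<open>b\<^sub>j\<close> need not lie in the field \<open>K\<close> obtained by adjoining the \<open>\<surd>d\<^sub>j\<close> to the field of coefficients,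
  so something has to be shown about the weighted sums. Call the absolute value of the imaginary
  parts the height of a conjugate pair of roots. The claim is that for each \<open>D\<close> the monic
  polynomial whose roots are the real parts of the pairs of height \<open>D\<close> has coefficients in
  \<open>K\<close> (\<open>poly_over_height_factors\<close>; the proof is carried out over the field generated by \<open>\<i>\<close> and the
  real elements of \<open>K\<close>, which contains no further real numbers). Indeed, if \<open>H\<close> is the greatest height, then shifting the
  dehomogenized form \<open>P\<close> by \<open>\<i>H\<close> down and up moves all its roots into the closed lower and the closed
  upper half plane respectively, and precisely one root of each pair of height \<open>H\<close> becomes
  real. The greatest common divisor of the two shifts is thus the polynomial for height \<open>H\<close>, and the Euclidean algorithm stays
  in the field. Dividing out the corresponding conjugate pairs leaves a form with fewer heights.
  The weighted sums are then combinations of the power sums of each height polynomial.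
\<close>

section \<open>Polynomials over a subfield\<close>

definition poly_over :: "'a::field set \<Rightarrow> 'a poly \<Rightarrow> bool" where
  "poly_over K p \<longleftrightarrow> (\<forall>n. coeff p n \<in> K)"

lemma poly_over_coeff: "poly_over K p \<Longrightarrow> coeff p n \<in> K"
  by (simp add: poly_over_def)

context
  fixes K :: "'a::field set"
  assumes K: "is_subfield K"
begin

lemma subfield_0: "0 \<in> K" and subfield_1: "1 \<in> K"
  and subfield_add: "x \<in> K \<Longrightarrow> y \<in> K \<Longrightarrow> x + y \<in> K"
  and subfield_mult: "x \<in> K \<Longrightarrow> y \<in> K \<Longrightarrow> x * y \<in> K"
  and subfield_uminus: "x \<in> K \<Longrightarrow> - x \<in> K"
  and subfield_inverse: "x \<in> K \<Longrightarrow> inverse x \<in> K"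
  using K by (auto simp: is_subfield_def)

lemma subfield_diff: "x \<in> K \<Longrightarrow> y \<in> K \<Longrightarrow> x - y \<in> K"
  using subfield_add[of x "- y"] subfield_uminus by simp

lemma subfield_divide: "x \<in> K \<Longrightarrow> y \<in> K \<Longrightarrow> x / y \<in> K"
  using subfield_mult[of x "inverse y"] subfield_inverse by (simp add: divide_inverse)

lemma subfield_sum: "(\<And>i. i \<in> A \<Longrightarrow> f i \<in> K) \<Longrightarrow> sum f A \<in> K"
  by (induction A rule: infinite_finite_induct) (auto intro: subfield_0 subfield_add)

lemma subfield_power: "x \<in> K \<Longrightarrow> x ^ n \<in> K"
  by (induction n) (auto intro: subfield_1 subfield_mult)

lemma subfield_of_nat: "of_nat n \<in> K"
  by (induction n) (auto intro: subfield_0 subfield_1 subfield_add)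

lemma subfield_numeral: "numeral n \<in> K"
  using subfield_of_nat[of "numeral n"] by simp

lemma poly_over_add: "poly_over K p \<Longrightarrow> poly_over K q \<Longrightarrow> poly_over K (p + q)"
  by (auto simp: poly_over_def intro: subfield_add)

lemma poly_over_diff: "poly_over K p \<Longrightarrow> poly_over K q \<Longrightarrow> poly_over K (p - q)"
  by (auto simp: poly_over_def intro: subfield_diff)

lemma poly_over_mult: "poly_over K p \<Longrightarrow> poly_over K q \<Longrightarrow> poly_over K (p * q)"
  by (auto simp: poly_over_def coeff_mult intro!: subfield_sum subfield_mult)

lemma poly_over_prod: "(\<And>i. i \<in> A \<Longrightarrow> poly_over K (f i)) \<Longrightarrow> poly_over K (prod f A)"
  by (induction A rule: infinite_finite_induct)
     (auto intro!: poly_over_mult, auto simp: poly_over_def subfield_0 subfield_1)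

lemma poly_over_smult: "c \<in> K \<Longrightarrow> poly_over K p \<Longrightarrow> poly_over K (smult c p)"
  by (auto simp: poly_over_def intro: subfield_mult)

lemma poly_over_monom: "c \<in> K \<Longrightarrow> poly_over K (monom c n)"
  by (auto simp: poly_over_def intro: subfield_0)

lemma poly_over_shift: "poly_over K p \<Longrightarrow> c \<in> K \<Longrightarrow> poly_over K (pcompose p [:c, 1:])"
  unfolding poly_over_def
  by (intro allI coeff_pcompose_semiring_closed)
     (auto simp: coeff_pCons split: nat.splits intro: subfield_0 subfield_1 subfield_add subfield_mult)

lemma poly_over_reflect: "poly_over K p \<Longrightarrow> poly_over K (reflect_poly p)"
  by (auto simp: poly_over_def coeff_reflect_poly intro: subfield_0)

text \<open>Long division by a monic polynomial only ever uses ring operations on coefficients; the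
  leading coefficient of the quotient is that of the product, so it can be split off.\<close>

lemma poly_over_cofactor:
  assumes "lead_coeff g = 1" "poly_over K g" "poly_over K (g * h)"
  shows "poly_over K h"
  using assms(3)
proof (induction "if h = 0 then 0 else Suc (degree h)" arbitrary: h rule: less_induct)
  case less
  show ?case
  proof (cases "h = 0")
    case True
    then show ?thesis by (simp add: poly_over_def subfield_0)
  next
    case False
    define m where "m = monom (lead_coeff h) (degree h)"
    have "lead_coeff h = lead_coeff (g * h)"
      using assms(1) by (simp add: lead_coeff_mult)
    then have m: "poly_over K m"
      unfolding m_def using poly_over_coeff[OF less.prems] by (simp only: poly_over_monom)
    have "degree (h - m) \<le> degree h" "coeff (h - m) (degree h) = 0"
      by (auto simp: m_def intro: degree_diff_le degree_monom_le)
    then have dec: "h - m = 0 \<or> degree (h - m) < degree h"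
      by (rule eq_zero_or_degree_less)
    have "poly_over K (g * (h - m))"
      using poly_over_diff[OF less.prems poly_over_mult[OF assms(2) m]] by (simp add: algebra_simps)
    then have "poly_over K (h - m)"
      using less.hyps[of "h - m"] dec False by auto
    from poly_over_add[OF this m] have "poly_over K (h - m + m)" .
    then show ?thesis by simp
  qed
qed

end

text \<open>A greatest common divisor is computed by the Euclidean algorithm inside the field of the
  coefficients. The hypothesis on common roots says that \<open>g\<close> is the full common factor; it is
  invariant under a Euclidean step applied to the cofactors.\<close>

lemma poly_over_common_factor:
  fixes g p q :: "'a::alg_closed_field poly"
  assumes K: "is_subfield K" and g: "lead_coeff g = 1"
    and "poly_over K (g * p)" "poly_over K (g * q)"
    and "\<And>x. poly p x \<noteq> 0 \<or> poly q x \<noteq> 0"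
  shows "poly_over K g"
proof -
  \<comment> \<open>The zero polynomial must count as smaller than the nonzero constants for the algorithm to
    terminate.\<close>
  define s where "s p = (if p = 0 then 0 else Suc (degree p))" for p :: "'a poly"
  \<comment> \<open>When one cofactor has become zero, the other one has no roots and so is a constant.\<close>
  have unit_cofactor: "poly_over K g"
    if "poly_over K (g * p)" "\<And>x. poly p x \<noteq> 0" for p
  proof -
    have "degree p = 0"
      using alg_closed_imp_poly_has_root[of p] that(2) by auto
    then obtain c where p: "p = [:c:]" by (auto elim: degree_eq_zeroE)
    have c: "c \<noteq> 0" using that(2) p by auto
    have gp: "g * p = smult c g" by (simp add: p)
    have "lead_coeff (smult c g) = c" using g by simp
    then have "c \<in> K" using poly_over_coeff[OF that(1), of "degree (g * p)"] by (simp only: gp)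
    then have "poly_over K (smult (inverse c) (smult c g))"
      using that(1) unfolding gp by (rule poly_over_smult[OF K subfield_inverse[OF K]])
    then show ?thesis using c by simp
  qed
  have reduce: "\<exists>m. s (p - m * q) < s p \<and> poly_over K (g * (p - m * q))"
    if "poly_over K (g * p)" "poly_over K (g * q)" "p \<noteq> 0" "q \<noteq> 0" "degree q \<le> degree p" for p q
  proof -
    define m where "m = monom (lead_coeff p / lead_coeff q) (degree p - degree q)"
    have "lead_coeff p = lead_coeff (g * p)" "lead_coeff q = lead_coeff (g * q)"
      using g by (simp_all add: lead_coeff_mult)
    then have "lead_coeff p \<in> K" "lead_coeff q \<in> K"
      using poly_over_coeff[OF that(1)] poly_over_coeff[OF that(2)] by (simp_all only:)
    then have m: "poly_over K m"
      unfolding m_def by (intro poly_over_monom[OF K] subfield_divide[OF K])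
    have m0: "m \<noteq> 0" using that by (simp add: m_def)
    have dm: "degree (m * q) = degree p"
      using that m0 by (simp add: degree_mult_eq) (simp add: m_def degree_monom_eq)
    have "lead_coeff (m * q) = lead_coeff p"
      using that by (simp add: lead_coeff_mult m_def degree_monom_eq)
    then have "coeff (p - m * q) (degree p) = 0" by (simp add: dm)
    moreover have "degree (p - m * q) \<le> degree p" by (intro degree_diff_le) (simp_all add: dm)
    ultimately have "p - m * q = 0 \<or> degree (p - m * q) < degree p"
      by (intro eq_zero_or_degree_less)
    then have "s (p - m * q) < s p" using that by (auto simp: s_def)
    moreover have "poly_over K (g * (p - m * q))"
      using poly_over_diff[OF K that(1) poly_over_mult[OF K m that(2)]] by (simp add: algebra_simps)
    ultimately show ?thesis by blast
  qed
  show ?thesis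
    using assms(3-5)
  proof (induction "s p + s q" arbitrary: p q rule: less_induct)
    case less
    consider "p = 0" | "q = 0" | "p \<noteq> 0" "q \<noteq> 0" "degree q \<le> degree p"
      | "p \<noteq> 0" "q \<noteq> 0" "degree p \<le> degree q" by linarith
    then show ?case
    proof cases
      case 1 then show ?thesis using less.prems unit_cofactor[of q] by auto
    next
      case 2 then show ?thesis using less.prems unit_cofactor[of p] by auto
    next
      case 3
      with reduce less.prems obtain m
        where m: "s (p - m * q) < s p" "poly_over K (g * (p - m * q))" by blast
      show ?thesis
      proof (rule less.hyps[of "p - m * q" q])
        fix x show "poly (p - m * q) x \<noteq> 0 \<or> poly q x \<noteq> 0" using less.prems(3)[of x] by auto
      qed (use m less.prems in auto)
    next
      case 4
      with reduce less.prems obtain m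
        where m: "s (q - m * p) < s q" "poly_over K (g * (q - m * p))" by blast
      show ?thesis
      proof (rule less.hyps[of p "q - m * p"])
        fix x show "poly p x \<noteq> 0 \<or> poly (q - m * p) x \<noteq> 0" using less.prems(3)[of x] by auto
      qed (use m less.prems in auto)
    qed
  qed
qed

section \<open>Separating conjugate pairs of roots by their height\<close>

text \<open>The roots are \<open>- c\<^sub>j \<plusminus> \<i> h\<^sub>j\<close>. The induction removes all pairs of greatest height \<open>H\<close> at once:
  their real parts are the roots of the greatest common divisor of the shifts of the product by
  \<open>\<plusminus> \<i>H\<close>.\<close>

lemma poly_over_height_factors:
  fixes c h :: "'i \<Rightarrow> real" and M :: "complex set"
  assumes M: "is_subfield M" and i: "\<i> \<in> M"
    and "finite I" and "\<And>j. j \<in> I \<Longrightarrow> h j > 0" and "\<And>j. j \<in> I \<Longrightarrow> complex_of_real (h j) \<in> M"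
    and "poly_over M (\<Prod>j\<in>I. [:Complex (c j) (h j), 1:] * [:Complex (c j) (- h j), 1:])"
  shows "poly_over M (\<Prod>j | j \<in> I \<and> h j = D. [:complex_of_real (c j), 1:])"
  using assms(3-6)
proof (induction I rule: finite_psubset_induct)
  case (psubset I)
  define P where "P A = (\<Prod>j\<in>A. [:Complex (c j) (h j), 1:] * [:Complex (c j) (- h j), 1:])" for A
  show ?case
  proof (cases "I = {}")
    case True
    then show ?thesis by (simp add: poly_over_def subfield_0[OF M] subfield_1[OF M])
  next
    case False
    define H where "H = Max (h ` I)"
    define J where "J = {j \<in> I. h j = H}"
    have "H \<in> h ` I" unfolding H_def using False psubset.hyps by (intro Max_in) auto
    then have J: "J \<noteq> {}" "J \<subseteq> I" and HM: "complex_of_real H \<in> M" and H0: "H > 0"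
      using psubset.prems by (auto simp: J_def)
    have le: "h j \<le> H" if "j \<in> I" for j
      unfolding H_def using that psubset.hyps by (intro Max_ge) auto
    have lt: "h j < H" if "j \<in> I - J" for j
      using le[of j] that by (force simp: J_def)
    define Q where "Q = (\<Prod>j\<in>J. [:complex_of_real (c j), 1:])"
    have Q1: "lead_coeff Q = 1" by (simp add: Q_def lead_coeff_prod)
    have shift_pair: "pcompose [:a, 1:] [:b, 1:] = [:a + b, 1:]" for a b :: complex
      by (simp add: pcompose_pCons)
    have shiftM: "\<i> * complex_of_real (s * H) \<in> M" if "s \<in> {1, -1}" for s
      using that subfield_mult[OF M i HM] subfield_uminus[OF M subfield_mult[OF M i HM]] by auto
    \<comment> \<open>The cofactor of \<open>Q\<close> in the shift of the product in the direction \<open>s = \<plusminus>1\<close>. For \<open>j\<close> outside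
      \<open>J\<close> neither of the two shifted roots is real; for \<open>j\<close> in \<open>J\<close> one is real and belongs to \<open>Q\<close>.\<close>
    define R where "R s = (\<Prod>j\<in>I. [:Complex (c j) (s * (h j + H)), 1:]) *
        (\<Prod>j\<in>I - J. [:Complex (c j) (s * (H - h j)), 1:])" for s
    have shift: "pcompose (P I) [:\<i> * complex_of_real (s * H), 1:] = Q * R s"
      if s: "s \<in> {1, -1}" for s
    proof -
      have "pcompose (P I) [:\<i> * complex_of_real (s * H), 1:] =
          (\<Prod>j\<in>I. [:Complex (c j) (s * (h j + H)), 1:] * [:Complex (c j) (s * (H - h j)), 1:])"
        unfolding P_def pcompose_prod pcompose_mult shift_pair
        using s by (intro prod.cong) (auto simp: complex_eq_iff algebra_simps)
      also have "\<dots> = (\<Prod>j\<in>I. [:Complex (c j) (s * (h j + H)), 1:]) *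
          (\<Prod>j\<in>I. [:Complex (c j) (s * (H - h j)), 1:])"
        by (rule prod.distrib)
      also have "(\<Prod>j\<in>I. [:Complex (c j) (s * (H - h j)), 1:]) =
          (\<Prod>j\<in>I - J. [:Complex (c j) (s * (H - h j)), 1:]) * Q"
        unfolding Q_def prod.subset_diff[OF J(2) psubset.hyps]
        by (intro arg_cong2[where f = "(*)"] prod.cong) (auto simp: J_def complex_eq_iff)
      finally show ?thesis by (simp add: R_def mult_ac)
    qed
    have roots: "s * Im x < 0" if "poly (R s) x = 0" "s \<in> {1, -1}" for s x
    proof -
      have "(\<exists>j\<in>I. Complex (c j) (s * (h j + H)) + x = 0) \<or>
          (\<exists>j\<in>I - J. Complex (c j) (s * (H - h j)) + x = 0)"
        using that(1) psubset.hyps by (auto simp: R_def poly_prod prod_zero_iff)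
      then obtain t where t: "t > 0" "Im x = - (s * t)"
      proof
        assume "\<exists>j\<in>I. Complex (c j) (s * (h j + H)) + x = 0"
        then obtain j where "j \<in> I" "Complex (c j) (s * (h j + H)) + x = 0" by blast
        then show ?thesis using that[of "h j + H"] H0 psubset.prems(1)[of j]
          by (auto simp: complex_eq_iff)
      next
        assume "\<exists>j\<in>I - J. Complex (c j) (s * (H - h j)) + x = 0"
        then obtain j where "j \<in> I - J" "Complex (c j) (s * (H - h j)) + x = 0" by blast
        then show ?thesis using that[of "H - h j"] lt[of j]
          by (auto simp: complex_eq_iff)
      qed
      then show ?thesis using that(2) by auto
    qed
    have "poly_over M (Q * R s)" if "s \<in> {1, -1}" for s
      unfolding shift[OF that, symmetric]
      using psubset.prems(3) shiftM[OF that] by (intro poly_over_shift[OF M]) (simp_all add: P_def)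
    then have QM: "poly_over M Q"
      using roots[of 1] roots[of "-1"]
      by (intro poly_over_common_factor[OF M Q1, of "R 1" "R (-1)"]) force+
    have "P J = pcompose Q [:\<i> * complex_of_real (1 * H), 1:] *
        pcompose Q [:\<i> * complex_of_real (-1 * H), 1:]"
      unfolding P_def Q_def pcompose_prod shift_pair prod.distrib
      by (intro arg_cong2[where f = "(*)"] prod.cong) (auto simp: J_def complex_eq_iff)
    then have PJ: "poly_over M (P J)"
      using shiftM[of 1] shiftM[of "-1"] by (auto intro!: poly_over_mult[OF M] poly_over_shift[OF M] QM)
    have "P I = P J * P (I - J)"
      unfolding P_def prod.subset_diff[OF J(2) psubset.hyps] by (rule mult.commute)
    moreover have "lead_coeff (P J) = 1" by (simp add: P_def lead_coeff_prod lead_coeff_mult del: mult_pCons_left mult_pCons_right)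
    ultimately have rest: "poly_over M (P (I - J))"
      by (metis P_def PJ M psubset.prems(3) poly_over_cofactor)
    show ?thesis
    proof (cases "D = H")
      case True
      then show ?thesis using QM by (simp add: Q_def J_def)
    next
      case False
      then have "{j. j \<in> I \<and> h j = D} = {j. j \<in> I - J \<and> h j = D}" by (auto simp: J_def)
      moreover have "poly_over M (\<Prod>j | j \<in> I - J \<and> h j = D. [:complex_of_real (c j), 1:])"
        using J rest psubset.prems by (intro psubset.IH) (auto simp: P_def)
      ultimately show ?thesis by simp
    qed
  qed
qed

text \<open>The second power sum comes from \<open>\<Sum> c\<^sub>j\<^sup>2 = e\<^sub>1\<^sup>2 - 2 e\<^sub>2\<close>. Reflecting the polynomial moves the
  elementary symmetric functions \<open>e\<^sub>1\<close> and \<open>e\<^sub>2\<close> to the fixed positions \<open>1\<close> and \<open>2\<close>, independent of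
  the degree.\<close>

lemma power_sums_in_subfield:
  fixes c :: "'i \<Rightarrow> 'a::field_char_0"
  assumes K: "is_subfield K" and "finite J" and "poly_over K (\<Prod>j\<in>J. [:c j, 1:])"
  shows "(\<Sum>j\<in>J. c j) \<in> K" and "(\<Sum>j\<in>J. (c j)\<^sup>2) \<in> K"
proof -
  define R where "R A = (\<Prod>j\<in>A. [:1, c j:])" for A
  have "reflect_poly (\<Prod>j\<in>J. [:c j, 1:]) = R J"
    unfolding reflect_poly_prod R_def
    by (intro prod.cong) (auto simp: reflect_poly_def)
  then have R: "coeff (R J) n \<in> K" for n
    using poly_over_reflect[OF K assms(3)] by (simp add: poly_over_def)
  have "coeff (R J) 0 = 1 \<and> coeff (R J) 1 = (\<Sum>j\<in>J. c j) \<and>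
      2 * coeff (R J) 2 = (\<Sum>j\<in>J. c j)\<^sup>2 - (\<Sum>j\<in>J. (c j)\<^sup>2)"
    using assms(2)
  proof (induction J rule: finite_induct)
    case (insert j J)
    have "R (insert j J) = R J + pCons 0 (smult (c j) (R J))"
      using insert.hyps by (simp add: R_def)
    then show ?case
      using insert by (simp add: coeff_pCons numeral_2_eq_2 power2_eq_square algebra_simps)
  qed (simp add: R_def)
  then have "(\<Sum>j\<in>J. c j) = coeff (R J) 1"
    and "(\<Sum>j\<in>J. (c j)\<^sup>2) = (coeff (R J) 1)\<^sup>2 - 2 * coeff (R J) 2" by auto
  then show "(\<Sum>j\<in>J. c j) \<in> K" and "(\<Sum>j\<in>J. (c j)\<^sup>2) \<in> K"
    by (auto intro!: subfield_diff[OF K] subfield_mult[OF K] subfield_power[OF K] subfield_numeral[OF K] R)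
qed

text \<open>The weight is constant on each group of equal height, so the sums reduce to power sums over the
  groups.\<close>

lemma height_weighted_sums_in_subfield:
  fixes c h :: "'i \<Rightarrow> real" and M :: "complex set"
  assumes M: "is_subfield M" and i: "\<i> \<in> M"
    and I: "finite I" and "\<And>j. j \<in> I \<Longrightarrow> h j > 0"
    and h: "\<And>j. j \<in> I \<Longrightarrow> complex_of_real (h j) \<in> M"
    and "poly_over M (\<Prod>j\<in>I. [:Complex (c j) (h j), 1:] * [:Complex (c j) (- h j), 1:])"
  shows "complex_of_real (\<Sum>j\<in>I. c j / h j) \<in> M"
    and "complex_of_real (\<Sum>j\<in>I. (c j)\<^sup>2 / h j) \<in> M"
proof -
  have group: "complex_of_real (\<Sum>j\<in>I. f j / h j) =
      (\<Sum>D\<in>h ` I. (\<Sum>j | j \<in> I \<and> h j = D. complex_of_real (f j)) / complex_of_real D)" for f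
    unfolding sum.image_gen[OF I, of "\<lambda>j. f j / h j" h]
    by (simp add: sum_divide_distrib)
  have linear: "(\<Sum>j | j \<in> I \<and> h j = D. complex_of_real (c j)) \<in> M"
    and quadratic: "(\<Sum>j | j \<in> I \<and> h j = D. complex_of_real ((c j)\<^sup>2)) \<in> M" for D
    using power_sums_in_subfield[OF M _ poly_over_height_factors[OF assms], of D] I by simp_all
  have heights: "complex_of_real D \<in> M" if "D \<in> h ` I" for D
    using that h by auto
  show "complex_of_real (\<Sum>j\<in>I. c j / h j) \<in> M"
    unfolding group by (rule subfield_sum[OF M], rule subfield_divide[OF M linear heights])
  show "complex_of_real (\<Sum>j\<in>I. (c j)\<^sup>2 / h j) \<in> M"
    unfolding group by (rule subfield_sum[OF M], rule subfield_divide[OF M quadratic heights])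
qed

section \<open>The hyperbolic center in closed form\<close>

text \<open>Dividing numerator and denominator by the product of all \<open>y\<^sub>j\<close> turns the products that omit one
  factor into weights \<open>1 / y\<^sub>i\<close>.\<close>

lemma psi_eq_weighted_mean:
  assumes "\<And>i. i \<in> {1..n} \<Longrightarrow> y i \<noteq> 0"
  shows "psi n x y = (\<Sum>i = 1..n. x i / y i) / (\<Sum>i = 1..n. 1 / y i)"
proof -
  define Y where "Y = (\<Prod>j = 1..n. y j)"
  have Y0: "Y \<noteq> 0" using assms by (auto simp: Y_def prod_zero_iff)
  have omit: "(\<Prod>j = 1..<i. y j) * (\<Prod>j = i+1..n. y j) = Y / y i" if "i \<in> {1..n}" for i
  proof -
    have split: "{1..n} - {i} = {1..<i} \<union> {i+1..n}" using that by auto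
    have "prod y ({1..n} - {i}) = (\<Prod>j = 1..<i. y j) * (\<Prod>j = i+1..n. y j)"
      unfolding split by (rule prod.union_disjoint) auto
    then have "Y = y i * ((\<Prod>j = 1..<i. y j) * (\<Prod>j = i+1..n. y j))"
      unfolding Y_def using prod.remove[OF finite_atLeastAtMost that, of y] by metis
    then show ?thesis using assms[OF that] by simp
  qed
  have "(\<Sum>i = 1..n. (\<Prod>j = 1..<i. y j) * x i * (\<Prod>j = i+1..n. y j)) = Y * (\<Sum>i = 1..n. x i / y i)"
    unfolding sum_distrib_left
  proof (rule sum.cong)
    fix i assume "i \<in> {1..n}"
    from omit[OF this] show "(\<Prod>j = 1..<i. y j) * x i * (\<Prod>j = i+1..n. y j) = Y * (x i / y i)"
      by (simp add: field_simps)
  qed simp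
  moreover have "(\<Sum>i = 1..n. (\<Prod>j = 1..<i. y j) * (\<Prod>j = i+1..n. y j)) = Y * (\<Sum>i = 1..n. 1 / y i)"
    unfolding sum_distrib_left by (rule sum.cong[OF refl]) (simp only: omit times_divide_eq_right mult_1_right)
  ultimately show ?thesis using Y0 by (simp add: psi_def)
qed

text \<open>Expanding the squares separates \<open>w\<close> from the points, which enter only through three weighted
  sums.\<close>

lemma hyp_center_cost_expand:
  assumes "set \<alpha>s \<subseteq> upper_half_plane" "w \<in> upper_half_plane"
  shows "hyp_center_cost \<alpha>s w =
    ((\<Sum>\<alpha>\<leftarrow>\<alpha>s. 1 / Im \<alpha>) * (cmod w)\<^sup>2 - 2 * Re w * (\<Sum>\<alpha>\<leftarrow>\<alpha>s. Re \<alpha> / Im \<alpha>)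
      + (\<Sum>\<alpha>\<leftarrow>\<alpha>s. (cmod \<alpha>)\<^sup>2 / Im \<alpha>)) / Im w - 2 * real (length \<alpha>s)"
  using assms(1)
proof (induction \<alpha>s)
  case (Cons \<alpha> \<alpha>s)
  have "Im \<alpha> > 0" "Im w > 0" using Cons.prems assms(2) by (auto simp: upper_half_plane_def)
  then have "((Re w - Re \<alpha>)\<^sup>2 + (Im w - Im \<alpha>)\<^sup>2) / (Im w * Im \<alpha>) =
      (1 / Im \<alpha> * (cmod w)\<^sup>2 - 2 * Re w * (Re \<alpha> / Im \<alpha>) + (cmod \<alpha>)\<^sup>2 / Im \<alpha>) / Im w - 2"
    unfolding cmod_power2 by (simp add: field_simps power2_eq_square)
  then show ?case
    using Cons by (simp add: hyp_center_cost_def add_divide_distrib diff_divide_distrib ring_distribs)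
qed (simp add: hyp_center_cost_def)

text \<open>With \<open>w\<^sub>0 = t + \<i>u\<close> as claimed, \<open>B = S t\<close> and \<open>C = S |w\<^sub>0|\<^sup>2\<close>, so the numerator in the expansion of
  the cost is \<open>S |w - w\<^sub>0|\<^sup>2 + 2 S u Im w\<close>. Its last term contributes only a constant to the cost.\<close>

lemma hyp_center_closed_form:
  fixes \<alpha>s :: "complex list"
  defines "S \<equiv> (\<Sum>\<alpha>\<leftarrow>\<alpha>s. 1 / Im \<alpha>)" and "B \<equiv> (\<Sum>\<alpha>\<leftarrow>\<alpha>s. Re \<alpha> / Im \<alpha>)"
    and "C \<equiv> (\<Sum>\<alpha>\<leftarrow>\<alpha>s. (cmod \<alpha>)\<^sup>2 / Im \<alpha>)"
  assumes \<alpha>s: "set \<alpha>s \<subseteq> upper_half_plane" "\<alpha>s \<noteq> []"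
  shows "C / S - (B / S)\<^sup>2 > 0"
    and "hyp_center \<alpha>s = Complex (B / S) (sqrt (C / S - (B / S)\<^sup>2))"
proof -
  have pos: "(\<Sum>\<alpha>\<leftarrow>\<beta>s. f \<alpha>) > 0"
    if "\<And>\<alpha>. \<alpha> \<in> set \<beta>s \<Longrightarrow> f \<alpha> > 0" "\<beta>s \<noteq> []" for f :: "complex \<Rightarrow> real" and \<beta>s :: "complex list"
    using that
  proof (induction \<beta>s)
    case (Cons \<beta> \<beta>s)
    then show ?case by (cases "\<beta>s = []") (auto intro!: add_pos_pos)
  qed simp
  have S: "S > 0"
    unfolding S_def using \<alpha>s by (intro pos) (auto simp: upper_half_plane_def)
  define t where "t = B / S"
  \<comment> \<open>After division by \<open>S\<close> this shows that the number under the root is the weighted mean of the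
    squared distances from the points to the real point \<open>t\<close>.\<close>
  have "C - 2 * t * B + t\<^sup>2 * S = (\<Sum>\<alpha>\<leftarrow>\<alpha>s. ((Re \<alpha> - t)\<^sup>2 + (Im \<alpha>)\<^sup>2) / Im \<alpha>)"
    unfolding S_def B_def C_def using \<alpha>s(1)
  proof (induction \<alpha>s)
    case (Cons \<alpha> \<alpha>s)
    have "((Re \<alpha> - t)\<^sup>2 + (Im \<alpha>)\<^sup>2) / Im \<alpha> =
        (cmod \<alpha>)\<^sup>2 / Im \<alpha> - 2 * t * (Re \<alpha> / Im \<alpha>) + t\<^sup>2 * (1 / Im \<alpha>)"
      unfolding cmod_power2 using Cons.prems
      by (simp add: upper_half_plane_def field_simps power2_eq_square)
    then show ?case using Cons by (simp add: ring_distribs)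
  qed simp
  also have "\<dots> > 0"
    using \<alpha>s by (intro pos) (auto simp: upper_half_plane_def intro!: divide_pos_pos add_nonneg_pos)
  finally have "C - 2 * t * B + t\<^sup>2 * S > 0" .
  moreover have "C - 2 * t * B + t\<^sup>2 * S = S * (C / S - t\<^sup>2)"
    using S by (simp add: t_def field_simps power2_eq_square)
  ultimately show m: "C / S - (B / S)\<^sup>2 > 0"
    using S by (simp add: t_def zero_less_mult_iff)
  define u where "u = sqrt (C / S - (B / S)\<^sup>2)"
  have u: "u > 0" "u\<^sup>2 = C / S - t\<^sup>2" using m by (simp_all add: u_def t_def)
  define w0 where "w0 = Complex t u"
  have cost: "hyp_center_cost \<alpha>s w =
      S / Im w * (cmod (w - w0))\<^sup>2 + (2 * S * u - 2 * real (length \<alpha>s))"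
    if w: "w \<in> upper_half_plane" for w
  proof -
    have "Im w > 0" using w by (simp add: upper_half_plane_def)
    have B: "B = S * t" and C: "C = S * (t\<^sup>2 + u\<^sup>2)" using S u(2) by (simp_all add: t_def)
    show ?thesis
      unfolding hyp_center_cost_expand[OF \<alpha>s(1) w] S_def[symmetric] B_def[symmetric] C_def[symmetric]
      unfolding B C cmod_power2 using \<open>Im w > 0\<close>
      by (simp add: w0_def field_simps power2_eq_square)
  qed
  have w0: "w0 \<in> upper_half_plane" using u by (simp add: w0_def upper_half_plane_def)
  have min: "hyp_center_cost \<alpha>s w0 < hyp_center_cost \<alpha>s w"
    if "w \<in> upper_half_plane" "w \<noteq> w0" for w
    using that S unfolding cost[OF w0] cost[OF that(1)] by (simp add: upper_half_plane_def)
  have "hyp_center \<alpha>s = w0"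
    unfolding hyp_center_def
  proof (rule the_equality)
    show "is_arg_min (hyp_center_cost \<alpha>s) (\<lambda>v. v \<in> upper_half_plane) w0"
      using w0 min by (force simp: is_arg_min_def)
    show "w = w0" if "is_arg_min (hyp_center_cost \<alpha>s) (\<lambda>v. v \<in> upper_half_plane) w" for w
      using that w0 min[of w] by (auto simp: is_arg_min_def)
  qed
  then show "hyp_center \<alpha>s = Complex (B / S) (sqrt (C / S - (B / S)\<^sup>2))"
    by (simp add: w0_def t_def u_def)
qed

section \<open>Binary forms and their dehomogenizations\<close>

definition dehomogenize :: "complex poly poly \<Rightarrow> complex poly" where
  "dehomogenize F = map_poly (\<lambda>p. poly p 1) F"

lemma poly_dehomogenize: "poly (dehomogenize F) x = form_eval F x 1"
  by (induction F) (auto simp: dehomogenize_def form_eval_def map_poly_pCons)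

lemma dehomogenize_mult: "dehomogenize (F * G) = dehomogenize F * dehomogenize G"
  by (simp add: poly_eq_poly_eq_iff[symmetric] fun_eq_iff poly_dehomogenize form_eval_def)

lemma dehomogenize_prod_list: "dehomogenize (\<Prod>x\<leftarrow>xs. f x) = (\<Prod>x\<leftarrow>xs. dehomogenize (f x))"
  by (induction xs) (simp_all add: dehomogenize_mult, simp add: dehomogenize_def)

lemma dehomogenize_prod: "dehomogenize (\<Prod>i\<in>A. f i) = (\<Prod>i\<in>A. dehomogenize (f i))"
  by (induction A rule: infinite_finite_induct)
     (simp_all add: dehomogenize_mult, simp_all add: dehomogenize_def)

lemma poly_over_dehomogenize:
  assumes "is_subfield K" "defined_over K F"
  shows "poly_over K (dehomogenize F)"
  using assms unfolding poly_over_def defined_over_def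
  by (auto simp: dehomogenize_def coeff_map_poly poly_altdef intro!: subfield_sum)

lemma conj_quadratic_expand:
  "conj_quadratic \<alpha> = [:[:0, 0, complex_of_real ((cmod \<alpha>)\<^sup>2):], [:0, complex_of_real (- 2 * Re \<alpha>):], 1:]"
  unfolding complex_norm_square
  by (simp add: conj_quadratic_def var_X_def var_Z_def const_form_def complex_eq_iff)

lemma dehomogenize_conj_quadratic:
  "dehomogenize (conj_quadratic \<alpha>) = [:- \<alpha>, 1:] * [:- cnj \<alpha>, 1:]"
  unfolding conj_quadratic_expand complex_norm_square
  by (simp add: dehomogenize_def map_poly_pCons complex_eq_iff)

text \<open>Each factor \<open>conj_quadratic \<alpha>\<close> contributes the two roots \<open>\<alpha>\<close> and \<open>cnj \<alpha>\<close> to the dehomogenized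
  form, and exactly one of them lies in the upper half plane.\<close>

lemma mset_upper_roots_unique:
  assumes "set \<alpha>s \<subseteq> upper_half_plane" "set \<beta>s \<subseteq> upper_half_plane"
    and "(\<Prod>\<alpha>\<leftarrow>\<alpha>s. conj_quadratic \<alpha>) = (\<Prod>\<beta>\<leftarrow>\<beta>s. conj_quadratic \<beta>)"
  shows "mset \<alpha>s = mset \<beta>s"
proof -
  have "{#z \<in># proots (\<Prod>\<alpha>\<leftarrow>\<alpha>s. [:- \<alpha>, 1:] * [:- cnj \<alpha>, 1:]). Im z > 0#} = mset \<alpha>s"
    if "set \<alpha>s \<subseteq> upper_half_plane" for \<alpha>s
    using that
  proof (induction \<alpha>s)
    case (Cons \<alpha> \<alpha>s)
    have "(\<Prod>\<alpha>\<leftarrow>\<alpha>s. [:- \<alpha>, 1:] * [:- cnj \<alpha>, 1:]) \<noteq> 0"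
      by (auto simp: prod_list_zero_iff simp del: mult_pCons_left mult_pCons_right)
    then have "proots (\<Prod>\<alpha>\<leftarrow>\<alpha> # \<alpha>s. [:- \<alpha>, 1:] * [:- cnj \<alpha>, 1:]) =
        {#\<alpha>#} + {#cnj \<alpha>#} + proots (\<Prod>\<alpha>\<leftarrow>\<alpha>s. [:- \<alpha>, 1:] * [:- cnj \<alpha>, 1:])"
      by (simp add: proots_mult del: mult_pCons_left mult_pCons_right)
    then show ?case using Cons by (simp add: upper_half_plane_def)
  qed simp
  from this[OF assms(1)] this[OF assms(2)] arg_cong[OF assms(3), of dehomogenize] show ?thesis
    by (simp add: dehomogenize_prod_list dehomogenize_conj_quadratic)
qed

lemma hyp_center_mset_cong:
  assumes "mset \<alpha>s = mset \<beta>s"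
  shows "hyp_center \<alpha>s = hyp_center \<beta>s"
proof -
  have "hyp_center_cost \<alpha>s = hyp_center_cost \<beta>s"
    unfolding hyp_center_cost_def sum_mset_sum_list[symmetric] mset_map assms ..
  then show ?thesis by (simp add: hyp_center_def)
qed

lemma hyp_center_zero_map_eq:
  assumes "set \<alpha>s \<subseteq> upper_half_plane" "complexify F = (\<Prod>\<alpha>\<leftarrow>\<alpha>s. conj_quadratic \<alpha>)"
  shows "hyp_center_zero_map F = hyp_center \<alpha>s"
proof -
  define \<beta>s where "\<beta>s = upper_roots F"
  have "set \<beta>s \<subseteq> upper_half_plane \<and> complexify F = (\<Prod>\<alpha>\<leftarrow>\<beta>s. conj_quadratic \<alpha>)"
    unfolding \<beta>s_def upper_roots_def by (rule someI) (use assms in blast)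
  then show ?thesis
    using mset_upper_roots_unique[of \<beta>s \<alpha>s] assms
    by (auto simp: hyp_center_zero_map_def \<beta>s_def intro!: hyp_center_mset_cong)
qed

lemma complexify_mult: "complexify (F * G) = complexify F * complexify G"
  by (intro poly_eqI) (simp add: complexify_def coeff_map_poly coeff_mult coeff_sum)

lemma complexify_prod: "complexify (\<Prod>i\<in>A. f i) = (\<Prod>i\<in>A. complexify (f i))"
  by (induction A rule: infinite_finite_induct) (simp_all add: complexify_mult, simp_all add: complexify_def)

lemma complexify_quadratic:
  assumes "(cmod \<alpha>)\<^sup>2 = b" "- 2 * Re \<alpha> = a"
  shows "complexify (var_X ^ 2 + const_form a * var_X * var_Z + const_form b * var_Z ^ 2) = conj_quadratic \<alpha>"
  unfolding conj_quadratic_expand assms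
  by (simp add: complexify_def var_X_def var_Z_def const_form_def power2_eq_square map_poly_pCons)

section \<open>The field of definition\<close>

text \<open>This is \<open>L(\<i>)\<close> for the field \<open>L\<close> of real elements of \<open>K\<close>. It contains \<open>\<i>\<close>, which the shifts of
  the roots by imaginary amounts require, but its real elements are still those of \<open>K\<close>.\<close>

lemma subfield_real_imaginary_parts:
  fixes K :: "complex set"
  assumes K: "is_subfield K"
  shows "is_subfield {z. complex_of_real (Re z) \<in> K \<and> complex_of_real (Im z) \<in> K}"
  unfolding is_subfield_def
  by (auto simp: subfield_0[OF K] subfield_1[OF K] of_real_inverse divide_inverse
      intro!: subfield_add[OF K] subfield_mult[OF K] subfield_diff[OF K] subfield_uminus[OF K]
        subfield_inverse[OF K] subfield_power[OF K])

text \<open>Only the symmetric information contained in the product is available about the individual \<open>a\<^sub>i\<close>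
  and \<open>b\<^sub>i\<close>, which may lie outside \<open>K\<close>; the heights \<open>d\<^sub>i / 2\<close> make it suffice. The sum of the
  \<open>b\<^sub>i / d\<^sub>i\<close> reduces to that of the \<open>a\<^sub>i\<^sup>2 / d\<^sub>i\<close> because \<open>4 b\<^sub>i = d\<^sub>i\<^sup>2 + a\<^sub>i\<^sup>2\<close>.\<close>

lemma psi_in_subfield:
  fixes a b d :: "nat \<Rightarrow> real" and K :: "complex set"
  assumes K: "is_subfield K"
    and d: "\<And>i. i \<in> {1..r} \<Longrightarrow> d i > 0" "\<And>i. i \<in> {1..r} \<Longrightarrow> complex_of_real (d i) \<in> K"
    and b: "\<And>i. i \<in> {1..r} \<Longrightarrow> 4 * b i = (d i)\<^sup>2 + (a i)\<^sup>2"
    and P: "poly_over K (\<Prod>i = 1..r. [:complex_of_real (b i), complex_of_real (a i), 1:])"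
  shows "complex_of_real (psi r a d) \<in> K" and "complex_of_real (psi r b d) \<in> K"
proof -
  define M where "M = {z. complex_of_real (Re z) \<in> K \<and> complex_of_real (Im z) \<in> K}"
  have M: "is_subfield M" unfolding M_def by (rule subfield_real_imaginary_parts[OF K])
  have i: "\<i> \<in> M" by (simp add: M_def subfield_0[OF K] subfield_1[OF K])
  have real_M: "complex_of_real x \<in> M \<longleftrightarrow> complex_of_real x \<in> K" for x
    by (simp add: M_def subfield_0[OF K])
  \<comment> \<open>The coefficients of the product are real elements of \<open>K\<close>, hence in \<open>M\<close>.\<close>
  have R: "is_subfield (\<real> :: complex set)"
    by (auto simp: is_subfield_def)
  have "poly_over \<real> (\<Prod>i = 1..r. [:complex_of_real (b i), complex_of_real (a i), 1:])"
    by (rule poly_over_prod[OF R]) (auto simp: poly_over_def coeff_pCons split: nat.splits)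
  with P have "poly_over M (\<Prod>i = 1..r. [:complex_of_real (b i), complex_of_real (a i), 1:])"
    unfolding poly_over_def by (metis Reals_cases real_M)
  also have "(\<Prod>i = 1..r. [:complex_of_real (b i), complex_of_real (a i), 1:]) =
      (\<Prod>i = 1..r. [:Complex (a i / 2) (d i / 2), 1:] * [:Complex (a i / 2) (- (d i / 2)), 1:])"
    using b by (intro prod.cong) (auto simp: complex_eq_iff field_simps power2_eq_square)
  finally have P': "poly_over M \<dots>" .
  have h: "d i / 2 > 0" "complex_of_real (d i / 2) \<in> M" if "i \<in> {1..r}" for i
    using d[OF that] subfield_divide[OF M, of "complex_of_real (d i)" 2] subfield_numeral[OF M]
    by (auto simp: real_M)
  have sums: "complex_of_real (\<Sum>i = 1..r. (a i / 2) / (d i / 2)) \<in> K"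
     "complex_of_real (\<Sum>i = 1..r. (a i / 2)\<^sup>2 / (d i / 2)) \<in> K"
    unfolding real_M[symmetric]
    by (rule height_weighted_sums_in_subfield[OF M i _ h P']; simp)+
  have inv: "complex_of_real (\<Sum>i = 1..r. 1 / d i) \<in> K"
    and heights: "complex_of_real (\<Sum>i = 1..r. d i) \<in> K"
    using d by (auto intro!: subfield_sum[OF K] subfield_divide[OF K] subfield_1[OF K])
  have psi: "complex_of_real (psi r x d) =
      complex_of_real (\<Sum>i = 1..r. x i / d i) / complex_of_real (\<Sum>i = 1..r. 1 / d i)" for x
    using d(1) by (subst psi_eq_weighted_mean) (force, rule of_real_divide)
  have "complex_of_real (\<Sum>i = 1..r. a i / d i) \<in> K" using sums(1) by simp
  then show "complex_of_real (psi r a d) \<in> K"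
    unfolding psi by (rule subfield_divide[OF K _ inv])
  have "(\<Sum>i = 1..r. b i / d i) =
      (\<Sum>i = 1..r. (a i / 2)\<^sup>2 / (d i / 2)) / 2 + (\<Sum>i = 1..r. d i) / 4"
    unfolding sum_divide_distrib sum.distrib[symmetric]
  proof (rule sum.cong)
    fix i assume "i \<in> {1..r}"
    with b[of i] d(1)[of i]
    show "b i / d i = (a i / 2)\<^sup>2 / (d i / 2) / 2 + d i / 4"
      by (simp add: field_simps power2_eq_square)
  qed simp
  then have "complex_of_real (\<Sum>i = 1..r. b i / d i) =
      complex_of_real (\<Sum>i = 1..r. (a i / 2)\<^sup>2 / (d i / 2)) / 2 + complex_of_real (\<Sum>i = 1..r. d i) / 4"
    by (simp only: of_real_add of_real_divide of_real_numeral)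
  also have "\<dots> \<in> K"
    by (intro subfield_add[OF K] subfield_divide[OF K] subfield_numeral[OF K] sums heights)
  finally show "complex_of_real (psi r b d) \<in> K"
    unfolding psi by (rule subfield_divide[OF K _ inv])
qed

theorem proposition10:
  fixes r :: nat and a b d :: "nat \<Rightarrow> real" and F :: "real poly poly"
  assumes "r \<ge> 1"
    and "totally_complex F"
    and "F = (\<Prod>i = 1..r. var_X ^ 2 + const_form (a i) * var_X * var_Z
                           + const_form (b i) * var_Z ^ 2)"
    and "\<And>i. i \<in> {1..r} \<Longrightarrow> d i = sqrt (4 * b i - (a i)\<^sup>2)"
  shows "hyp_center_zero_map F \<in> upper_half_plane \<and>
    Re (hyp_center_zero_map F) = - (1 / 2) * psi r a d \<and>
    (Im (hyp_center_zero_map F))\<^sup>2 = psi r b d - (1 / 4) * (psi r a d)\<^sup>2 \<and>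
    (\<forall>k :: complex set. is_subfield k \<and> defined_over k (complexify F) \<longrightarrow>
       defined_over (adjoin k ((\<lambda>i. complex_of_real (sqrt (d i))) ` {1..r}))
         (hyp_center_quadratic F))"
proof -
  \<comment> \<open>Otherwise the \<open>i\<close>-th factor, and with it \<open>F\<close>, has a real root.\<close>
  have disc: "4 * b i - (a i)\<^sup>2 > 0" if i: "i \<in> {1..r}" for i
  proof (rule ccontr)
    assume "\<not> 4 * b i - (a i)\<^sup>2 > 0"
    then have "(sqrt ((a i)\<^sup>2 - 4 * b i))\<^sup>2 = (a i)\<^sup>2 - 4 * b i" by simp
    then have "((- a i + sqrt ((a i)\<^sup>2 - 4 * b i)) / 2)\<^sup>2
        + a i * ((- a i + sqrt ((a i)\<^sup>2 - 4 * b i)) / 2) + b i = 0"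
      by (simp add: field_simps power2_eq_square)
    then obtain x where x: "x\<^sup>2 + a i * x + b i = 0" by blast
    have "form_eval F x 1 = (\<Prod>i = 1..r. x\<^sup>2 + a i * x + b i)"
      by (simp add: assms(3) form_eval_def poly_prod var_X_def var_Z_def const_form_def mult_ac)
    also have "\<dots> = 0" using i x by (auto simp: prod_zero_iff)
    finally show False using assms(2) by (auto simp: totally_complex_def)
  qed
  have d: "d i > 0" "4 * b i = (d i)\<^sup>2 + (a i)\<^sup>2" if "i \<in> {1..r}" for i
    using disc[OF that] assms(4)[OF that] by simp_all
  define \<alpha> where "\<alpha> i = Complex (- a i / 2) (d i / 2)" for i
  have \<alpha>: "Re (\<alpha> i) = - a i / 2" "Im (\<alpha> i) = d i / 2" "(cmod (\<alpha> i))\<^sup>2 = b i" if "i \<in> {1..r}" for i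
    unfolding cmod_power2 using d[OF that]
    by (simp_all add: \<alpha>_def field_simps power2_eq_square)
  define \<alpha>s where "\<alpha>s = map \<alpha> [1..<Suc r]"
  have upper: "set \<alpha>s \<subseteq> upper_half_plane" "\<alpha>s \<noteq> []"
    using d assms(1) by (auto simp: \<alpha>s_def \<alpha>_def upper_half_plane_def simp del: upt_Suc)
  have list_sum: "(\<Sum>\<alpha>\<leftarrow>\<alpha>s. f \<alpha>) = (\<Sum>i = 1..r. f (\<alpha> i))" for f :: "complex \<Rightarrow> real"
    using sum.distinct_set_conv_list[of "[1..<Suc r]" "\<lambda>i. f (\<alpha> i)"]
    by (simp add: \<alpha>s_def o_def atLeastLessThanSuc_atLeastAtMost del: upt_Suc)
  have factors: "complexify F = (\<Prod>i = 1..r. conj_quadratic (\<alpha> i))"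
    unfolding assms(3) complexify_prod
    by (intro prod.cong complexify_quadratic) (simp_all add: \<alpha>)
  have "(\<Prod>i = 1..r. conj_quadratic (\<alpha> i)) = (\<Prod>\<alpha>\<leftarrow>\<alpha>s. conj_quadratic \<alpha>)"
    using prod.distinct_set_conv_list[of "[1..<Suc r]" "\<lambda>i. conj_quadratic (\<alpha> i)"]
    by (simp add: \<alpha>s_def o_def atLeastLessThanSuc_atLeastAtMost del: upt_Suc)
  with factors have F: "complexify F = (\<Prod>\<alpha>\<leftarrow>\<alpha>s. conj_quadratic \<alpha>)" by simp
  define S where "S = (\<Sum>\<alpha>\<leftarrow>\<alpha>s. 1 / Im \<alpha>)"
  define w where "w = hyp_center_zero_map F"
  have w: "w = hyp_center \<alpha>s"
    unfolding w_def by (rule hyp_center_zero_map_eq[OF upper(1) F])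
  have psi: "psi r x d = (\<Sum>i = 1..r. x i / d i) / (\<Sum>i = 1..r. 1 / d i)" for x
    using d by (intro psi_eq_weighted_mean) force
  have S: "S = 2 * (\<Sum>i = 1..r. 1 / d i)"
    by (simp add: S_def list_sum \<alpha> sum_distrib_left)
  have "(\<Sum>\<alpha>\<leftarrow>\<alpha>s. Re \<alpha> / Im \<alpha>) = - (\<Sum>i = 1..r. a i / d i)"
    by (simp add: list_sum \<alpha> sum_negf)
  then have t: "(\<Sum>\<alpha>\<leftarrow>\<alpha>s. Re \<alpha> / Im \<alpha>) / S = - (1 / 2) * psi r a d"
    by (simp add: S psi)
  have "(\<Sum>\<alpha>\<leftarrow>\<alpha>s. (cmod \<alpha>)\<^sup>2 / Im \<alpha>) = 2 * (\<Sum>i = 1..r. b i / d i)"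
    by (simp add: list_sum \<alpha> sum_distrib_left mult_ac)
  then have C: "(\<Sum>\<alpha>\<leftarrow>\<alpha>s. (cmod \<alpha>)\<^sup>2 / Im \<alpha>) / S = psi r b d"
    by (simp add: S psi)
  note center = hyp_center_closed_form[OF upper, folded S_def w, unfolded t C]
  have Re_w: "Re w = - (1 / 2) * psi r a d" using center(2) by simp
  have Im_w: "(Im w)\<^sup>2 = psi r b d - (1 / 4) * (psi r a d)\<^sup>2"
    using center by (simp add: power_mult_distrib power2_eq_square)
  have w_upper: "w \<in> upper_half_plane" using center by (simp add: upper_half_plane_def)
  have quadratic: "hyp_center_quadratic F =
      [:[:0, 0, complex_of_real (psi r b d):], [:0, complex_of_real (psi r a d):], 1:]"
    unfolding hyp_center_quadratic_def w_def[symmetric] conj_quadratic_expand cmod_power2 Im_w Re_w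
    by (simp add: power2_eq_square)
  have "defined_over (adjoin k ((\<lambda>i. complex_of_real (sqrt (d i))) ` {1..r})) (hyp_center_quadratic F)"
    if k: "defined_over k (complexify F)" for k
  proof -
    define K where "K = adjoin k ((\<lambda>i. complex_of_real (sqrt (d i))) ` {1..r})"
    have K: "is_subfield K" unfolding K_def by (rule is_subfield_adjoin)
    have "k \<subseteq> K" unfolding K_def adjoin_def by auto
    have dK: "complex_of_real (d i) \<in> K" if i: "i \<in> {1..r}" for i
    proof -
      have "complex_of_real (sqrt (d i)) \<in> K" using i unfolding K_def adjoin_def by auto
      then have "complex_of_real (sqrt (d i)) ^ 2 \<in> K" by (rule subfield_power[OF K])
      then show ?thesis using d(1)[OF i] by (simp flip: of_real_power)
    qed
    have "defined_over K (complexify F)" using k \<open>k \<subseteq> K\<close> by (auto simp: defined_over_def)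
    then have "poly_over K (dehomogenize (complexify F))" by (rule poly_over_dehomogenize[OF K])
    also have "dehomogenize (complexify F) =
        (\<Prod>i = 1..r. [:complex_of_real (b i), complex_of_real (a i), 1:])"
      unfolding factors dehomogenize_prod conj_quadratic_expand
      by (intro prod.cong) (simp_all add: dehomogenize_def map_poly_pCons \<alpha>)
    finally have P: "poly_over K (\<Prod>i = 1..r. [:complex_of_real (b i), complex_of_real (a i), 1:])" .
    have "complex_of_real (psi r a d) \<in> K" "complex_of_real (psi r b d) \<in> K"
      by (rule psi_in_subfield[OF K d(1) dK d(2) P]; assumption)+
    then show ?thesis
      unfolding K_def[symmetric] quadratic
      by (auto simp: defined_over_def coeff_pCons subfield_0[OF K] subfield_1[OF K] split: nat.splits)
  qed
  then show ?thesis
    unfolding w_def[symmetric] using w_upper Re_w Im_w by blast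
qed

end
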